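(* Let $\ell>0$, and let $u_0$ and $v_\ell$ be the functions $$u_{0}(x)=\sup_{y\in\Omega}\min_{c^{*}\in G}\langle c^{*},F(x)-F(y)\rangle,\qquad v_{\ell}(x)=\sup_{y\in\Omega}\min_{c^{*}\in G}\{\langle c^{*},JF(x)(x-y)\rangle-\ell D_{\omega}(y,x)\}.$$ Then: (i) a point $x\in\Omega$ is a weakly efficient solution of the problem $\min_{x\in\Omega}F(x)$ (with respect to $C$) if and only if $u_0(x)=0$; (ii) a point $x\in\mathrm{int}(\Omega)$ is a $C$-stationary point of the problem $\min_{x\in\Omega}F(x)$ if and only if $v_\ell(x)=0$.
   Context: $C\subset\mathbb{R}^m$ is a closed, convex, pointed cone with nonempty interior; $y\preceq_C y'$ (resp. $y\prec_C y'$) means $y'-y\in C$ (resp. $y'-y\in\mathrm{int}(C)$). $C^*=\{c^*\in\mathbb{R}^m:\langle c^*,c\rangle\ge 0\ \forall c\in C\}$ and $G=\mathrm{conv}(\{c^*\in C^*:\|c^*\|=1\})$ (Euclidean norm). $\Omega\subset\mathbb{R}^n$ is closed and convex with nonempty interior, $F:\mathbb{R}^n\to\mathbb{R}^m$ is differentiable, with Jacobian $JF(x)\in\mathbb{R}^{m\times n}$. Legendre function: a proper closed convex function $\omega$ on $\mathbb{R}^n$ with values in $(-\infty,+\infty]$ that is essentially smooth (differentiable on $\mathrm{int}(\mathrm{dom}\,\omega)$, with $\|\nabla\omega(x^k)\|\to\infty$ for every sequence $\{x^k\}\subset\mathrm{int}(\mathrm{dom}\,\omega)$ converging to a boundary point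 of $\mathrm{dom}\,\omega$) and strictly convex on $\mathrm{int}(\mathrm{dom}\,\omega)$. Here $\omega$ is a Legendre function with $\mathrm{cl}(\mathrm{dom}\,\omega)=\Omega$ (so $\mathrm{int}(\mathrm{dom}\,\omega)=\mathrm{int}(\Omega)$). Bregman distance: $D_\omega(x,y)=\omega(x)-\omega(y)-\langle\nabla\omega(y),x-y\rangle$ for $y\in\mathrm{int}(\mathrm{dom}\,\omega)$ (equal to $+\infty$ when $\omega(x)=+\infty$). A point $x^*\in\Omega$ is weakly efficient if there is no $x\in\Omega$ with $F(x)\prec_C F(x^* )$. A point $x^*\in\Omega$ is $C$-stationary if $JF(x^* )(\Omega-x^* )\cap(-\mathrm{int}(C))=\emptyset$. *)

theory Defs
  imports "HOL-Analysis.Analysis"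
begin

definition pointed :: "'a::real_vector set \<Rightarrow> bool"
  where "pointed C \<longleftrightarrow> C \<inter> uminus ` C = {0}"

definition cone_less :: "'a::real_normed_vector set \<Rightarrow> 'a \<Rightarrow> 'a \<Rightarrow> bool"
  where "cone_less C y y' \<longleftrightarrow> y' - y \<in> interior C"

definition dual_cone :: "'a::real_inner set \<Rightarrow> 'a set"
  where "dual_cone C = {c'. \<forall>c\<in>C. c' \<bullet> c \<ge> 0}"

definition dual_base :: "'a::real_inner set \<Rightarrow> 'a set"
  where "dual_base C = convex hull {c' \<in> dual_cone C. norm c' = 1}"

definition effective_domain :: "('a \<Rightarrow> ereal) \<Rightarrow> 'a set"
  where "effective_domain f = {x. f x < \<infinity>}"

definition ereal_epigraph :: "('a \<Rightarrow> ereal) \<Rightarrow> ('a \<times> real) set"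
  where "ereal_epigraph f = {(x, r). f x \<le> ereal r}"

definition proper_function :: "('a \<Rightarrow> ereal) \<Rightarrow> bool"
  where "proper_function f \<longleftrightarrow> (\<forall>x. f x \<noteq> -\<infinity>) \<and> (\<exists>x. f x \<noteq> \<infinity>)"

definition strictly_convex_on :: "'a::real_vector set \<Rightarrow> ('a \<Rightarrow> ereal) \<Rightarrow> bool"
  where "strictly_convex_on S f \<longleftrightarrow>
    (\<forall>x\<in>S. \<forall>y\<in>S. \<forall>t. x \<noteq> y \<longrightarrow> 0 < t \<longrightarrow> t < 1 \<longrightarrow>
       f ((1 - t) *\<^sub>R x + t *\<^sub>R y) < ereal (1 - t) * f x + ereal t * f y)"

definition gradient :: "('a::real_inner \<Rightarrow> real) \<Rightarrow> 'a \<Rightarrow> 'a"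
  where "gradient f x = (THE D. GDERIV f x :> D)"

lemma gradient_eqI:
  assumes "GDERIV f x :> D"
  shows "gradient f x = D"
  unfolding gradient_def
proof (rule the_equality[of _ D])
  show "GDERIV f x :> D" by fact
next
  fix E assume "GDERIV f x :> E"
  then have "(\<lambda>h. h \<bullet> E) = (\<lambda>h. h \<bullet> D)"
    using assms has_derivative_unique unfolding gderiv_def by blast
  then have "\<forall>h. h \<bullet> (E - D) = 0"
    by (metis (no_types) cancel_comm_monoid_add_class.diff_cancel inner_diff_right)
  then show "E = D"
    by (metis eq_iff_diff_eq_0 inner_eq_zero_iff)
qed

text \<open>
  A proper function is real-valued on the interior of its effective domain, so there
  its derivative is that of its composition with \<^const>\<open>real_of_ereal\<close>.
\<close>

definition ereal_gradient :: "('a::real_inner \<Rightarrow> ereal) \<Rightarrow> 'a \<Rightarrow> 'a"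
  where "ereal_gradient f = gradient (\<lambda>x. real_of_ereal (f x))"

definition essentially_smooth :: "('a::real_inner \<Rightarrow> ereal) \<Rightarrow> bool"
  where "essentially_smooth f \<longleftrightarrow>
    (\<forall>x \<in> interior (effective_domain f). (\<lambda>y. real_of_ereal (f y)) differentiable (at x)) \<and>
    (\<forall>s b. (\<forall>k::nat. s k \<in> interior (effective_domain f)) \<longrightarrow>
       b \<in> frontier (effective_domain f) \<longrightarrow> s \<longlonglongrightarrow> b \<longrightarrow>
       filterlim (\<lambda>k. norm (ereal_gradient f (s k))) at_top sequentially)"

definition legendre_function :: "('a::real_inner \<Rightarrow> ereal) \<Rightarrow> bool"
  where "legendre_function f \<longleftrightarrow>
    proper_function f \<and> closed (ereal_epigraph f) \<and> convex (ereal_epigraph f) \<and>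
    essentially_smooth f \<and> strictly_convex_on (interior (effective_domain f)) f"

definition bregman :: "('a::real_inner \<Rightarrow> ereal) \<Rightarrow> 'a \<Rightarrow> 'a \<Rightarrow> ereal"
  where "bregman f x y = f x - f y - ereal (ereal_gradient f y \<bullet> (x - y))"

definition weakly_efficient ::
    "'b::real_normed_vector set \<Rightarrow> 'a set \<Rightarrow> ('a \<Rightarrow> 'b) \<Rightarrow> 'a \<Rightarrow> bool"
  where "weakly_efficient C \<Omega> F x \<longleftrightarrow> x \<in> \<Omega> \<and> \<not> (\<exists>y\<in>\<Omega>. cone_less C (F y) (F x))"

definition C_stationary ::
    "(real ^ 'm) set \<Rightarrow> (real ^ 'n) set \<Rightarrow> (real ^ 'n \<Rightarrow> real ^ 'm) \<Rightarrow> real ^ 'n \<Rightarrow> bool"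
  where "C_stationary C \<Omega> F x \<longleftrightarrow>
    x \<in> \<Omega> \<and> (\<lambda>y. jacobian F (at x) *v (y - x)) ` \<Omega> \<inter> uminus ` interior C = {}"

text \<open>
  The suprema may be infinite and \<^const>\<open>bregman\<close> may take the value \<open>\<infinity>\<close>, hence the values
  in \<^typ>\<open>ereal\<close>.  The infima over \<^const>\<open>dual_base\<close> are minima, by \<open>INF_dual_base_attained\<close>
  below; for \<open>merit_u\<close> take \<open>e = 0\<close>.
\<close>

definition merit_u ::
    "'b::real_inner set \<Rightarrow> 'a set \<Rightarrow> ('a \<Rightarrow> 'b) \<Rightarrow> 'a \<Rightarrow> ereal"
  where "merit_u C \<Omega> F x = (SUP y\<in>\<Omega>. INF c\<in>dual_base C. ereal (c \<bullet> (F x - F y)))"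

definition merit_v ::
    "(real ^ 'm) set \<Rightarrow> (real ^ 'n) set \<Rightarrow> (real ^ 'n \<Rightarrow> real ^ 'm) \<Rightarrow>
     (real ^ 'n \<Rightarrow> ereal) \<Rightarrow> real \<Rightarrow> real ^ 'n \<Rightarrow> ereal"
  where "merit_v C \<Omega> F \<omega> l x =
    (SUP y\<in>\<Omega>. INF c\<in>dual_base C.
       ereal (c \<bullet> (jacobian F (at x) *v (x - y))) - ereal l * bregman \<omega> y x)"

lemma compact_dual_base: "compact (dual_base (C :: 'a::euclidean_space set))"
proof -
  have eq: "{c' \<in> dual_cone C. norm c' = 1} = sphere 0 1 \<inter> (\<Inter>c\<in>C. {c'. c' \<bullet> c \<ge> 0})"
    by (auto simp: dual_cone_def)
  have "closed (\<Inter>c\<in>C. {c'. c' \<bullet> c \<ge> 0})"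
    by (intro closed_INT ballI closed_Collect_le continuous_intros)
  then show ?thesis
    unfolding dual_base_def eq by (intro compact_convex_hull compact_Int_closed) auto
qed

lemma dual_base_nonempty:
  fixes C :: "'a::euclidean_space set"
  assumes "closed C" "convex C" "cone C" "pointed C"
  shows "dual_base C \<noteq> {}"
proof -
  obtain b :: 'a where b: "b \<in> Basis" using nonempty_Basis by blast
  then have "b \<noteq> 0" by auto
  then have "b \<notin> C \<inter> uminus ` C" using assms(4) by (auto simp: pointed_def)
  then obtain z where z: "z \<notin> C" by (metis IntI UNIV_I image_eqI minus_minus)
  obtain a d where ad: "a \<bullet> z < d" "\<And>x. x \<in> C \<Longrightarrow> d < a \<bullet> x"
    using separating_hyperplane_closed_point[OF assms(2,1) z] by blast
  have "0 \<in> C" using assms(4) by (auto simp: pointed_def)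
  then have d: "d < 0" using ad(2) by force
  have "a \<bullet> x \<ge> 0" if x: "x \<in> C" for x
  proof (rule ccontr)
    assume "\<not> ?thesis"
    then have neg: "a \<bullet> x < 0" by simp
    then have "d / (a \<bullet> x) \<ge> 0" using d by (simp add: divide_nonpos_neg)
    then have "(d / (a \<bullet> x)) *\<^sub>R x \<in> C" using assms(3) x by (auto simp: cone_def)
    then show False using ad(2) neg by fastforce
  qed
  moreover have "a \<noteq> 0" using ad(1) d by auto
  ultimately have "a /\<^sub>R norm a \<in> {c' \<in> dual_cone C. norm c' = 1}"
    by (auto simp: dual_cone_def)
  then show ?thesis unfolding dual_base_def using hull_inc by fastforce
qed

lemma INF_dual_base_attained:
  fixes C :: "'a::euclidean_space set" and e :: ereal
  assumes "closed C" "convex C" "cone C" "pointed C"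
  shows "\<exists>c0\<in>dual_base C. (INF c\<in>dual_base C. ereal (c \<bullet> w) - e) = ereal (c0 \<bullet> w) - e"
proof -
  have "continuous_on (dual_base C) (\<lambda>c. c \<bullet> w)" by (intro continuous_intros)
  then obtain c0 where c0: "c0 \<in> dual_base C" "\<And>c. c \<in> dual_base C \<Longrightarrow> c0 \<bullet> w \<le> c \<bullet> w"
    using continuous_attains_inf[OF compact_dual_base dual_base_nonempty[OF assms]] by metis
  have "(INF c\<in>dual_base C. ereal (c \<bullet> w) - e) = ereal (c0 \<bullet> w) - e"
    using c0 by (intro antisym INF_lower INF_greatest ereal_minus_mono) auto
  with c0(1) show ?thesis by blast
qed

end

(*
The dual base G detects the interior of the cone: w lies in the interior of C if and only
if c \<bullet> w > 0 for every c in G.  As G is compact, this says that the minimum of c \<bullet> w over G is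
positive, which gives (i), the value at y = x being 0.  For (ii), the Bregman distance is
nonnegative, so stationarity bounds every term by 0; conversely, a descent direction y - x gains
at least m * t (with m > 0) at the point x + t (y - x), while the Bregman distance there is o(t).
*)
theory Submission
  imports Defs
begin

section \<open>The cone, its interior and the dual base\<close>

text \<open>Some ball of radius \<open>e\<close> about \<open>w\<close> fits in \<open>C\<close>, so
  a unit dual vector \<open>u\<close> can be tested on \<open>w - e *\<^sub>R u\<close>, which
  yields \<open>u \<bullet> w \<ge> e\<close>. Positivity passes to the convex hull because an open
  half-space is convex.\<close>

lemma dual_base_inner_pos:
  assumes w: "w \<in> interior C" and c: "c \<in> dual_base C"
  shows "c \<bullet> w > 0"
proof -
  have "w \<bullet> u > 0" if u: "u \<in> dual_cone C" "norm u = 1" for u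
  proof -
    obtain e where e: "e > 0" "cball w e \<subseteq> C" using w by (auto simp: mem_interior_cball)
    have "w - e *\<^sub>R u \<in> C" using e u(2) by (intro subsetD[OF e(2)]) (auto simp: dist_norm)
    then have "u \<bullet> (w - e *\<^sub>R u) \<ge> 0" using u(1) by (auto simp: dual_cone_def)
    then have "u \<bullet> w \<ge> e" using u(2) by (simp add: inner_diff_right dot_square_norm)
    then show ?thesis using e(1) by (simp add: inner_commute)
  qed
  then have "dual_base C \<subseteq> {u. w \<bullet> u > 0}"
    unfolding dual_base_def by (intro hull_minimal convex_halfspace_gt) auto
  then show ?thesis using c by (auto simp: inner_commute)
qed

text \<open>A hyperplane separates \<open>w\<close> from \<open>interior C\<close>. The inequality
  extends to \<open>C\<close>, which lies in the closure of its interior, and the cone property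
  makes the normal \<open>a\<close> a dual vector; normalised, it is the witness.\<close>

lemma exists_dual_base_inner_nonpos:
  fixes C :: "'a::euclidean_space set"
  assumes C: "convex C" "cone C" "interior C \<noteq> {}" and w: "w \<notin> interior C"
  shows "\<exists>c\<in>dual_base C. c \<bullet> w \<le> 0"
proof -
  obtain a b where a: "a \<noteq> 0" and aw: "a \<bullet> w \<le> b" and "\<forall>x\<in>interior C. a \<bullet> x \<ge> b"
    using separating_hyperplane_sets[of "{w}" "interior C"] C w convex_interior by auto
  then have "closure (interior C) \<subseteq> {x. a \<bullet> x \<ge> b}"
    by (intro closure_minimal closed_halfspace_ge) auto
  then have ge: "a \<bullet> x \<ge> b" if "x \<in> C" for x
    using that convex_closure_interior[OF C(1,3)] closure_subset by blast
  have "0 \<in> C" using C(2,3) cone_contains_0 interior_subset by blast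
  with ge have b: "b \<le> 0" by force
  have "a \<bullet> x \<ge> 0" if x: "x \<in> C" for x
  proof (rule ccontr)
    assume "\<not> ?thesis"
    then have neg: "a \<bullet> x < 0" by simp
    \<comment> \<open>The factor scales \<open>x\<close> to a point of \<open>C\<close> where
      \<open>a\<close> takes the value \<open>b - 1\<close>, strictly below the bound
      \<open>b\<close>.\<close>
    then have "(b - 1) / (a \<bullet> x) \<ge> 0" using b by (simp add: divide_nonpos_neg)
    then have "((b - 1) / (a \<bullet> x)) *\<^sub>R x \<in> C" using C(2) x by (auto simp: cone_def)
    then show False using ge neg by fastforce
  qed
  then have "a /\<^sub>R norm a \<in> dual_base C"
    unfolding dual_base_def using a by (intro hull_inc) (auto simp: dual_cone_def)
  moreover have "(a /\<^sub>R norm a) \<bullet> w \<le> 0"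
    using aw b by (simp add: mult_nonneg_nonpos)
  ultimately show ?thesis by blast
qed

section \<open>Convexity and gradients of Legendre functions\<close>

text \<open>Makes the library's theory of real-valued convex functions available. Properness
  excludes the value \<open>-\<infinity>\<close>, which \<open>real_of_ereal\<close> would turn into
  \<open>0\<close>.\<close>

lemma ereal_epigraph_eq_epigraph:
  assumes "proper_function f"
  shows "ereal_epigraph f = epigraph (effective_domain f) (\<lambda>x. real_of_ereal (f x))"
proof -
  have "f x \<le> ereal r \<longleftrightarrow> f x < \<infinity> \<and> real_of_ereal (f x) \<le> r" for x r
    using assms by (cases "f x") (auto simp: proper_function_def)
  then show ?thesis
    by (auto simp: ereal_epigraph_def epigraph_def effective_domain_def)
qed

lemma legendre_function_convex_on:
  assumes "legendre_function f"
  shows "convex_on (effective_domain f) (\<lambda>x. real_of_ereal (f x))"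
  using assms ereal_epigraph_eq_epigraph[of f] convex_epigraph
  unfolding legendre_function_def by metis

lemma proper_function_eq_ereal:
  assumes "proper_function f" "x \<in> effective_domain f"
  shows "f x = ereal (real_of_ereal (f x))"
  using assms by (cases "f x") (auto simp: proper_function_def effective_domain_def)

text \<open>The derivative is a linear functional, represented by its adjoint applied to
  \<open>1\<close>; so the description in \<open>gradient\<close> does denote a vector.\<close>

lemma differentiable_imp_gderiv_gradient:
  fixes f :: "'a::euclidean_space \<Rightarrow> real"
  assumes "f differentiable (at x)"
  shows "GDERIV f x :> gradient f x"
proof -
  obtain f' where f': "(f has_derivative f') (at x)"
    using assms by (auto simp: differentiable_def)
  have "f' = (\<lambda>h. h \<bullet> adjoint f' 1)"
    using adjoint_works[OF has_derivative_linear[OF f'], of _ 1] by (auto simp: fun_eq_iff)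
  with f' have "GDERIV f x :> adjoint f' 1" by (simp add: gderiv_def)
  then show ?thesis by (metis gradient_eqI)
qed

lemma gderiv_along_line:
  assumes "GDERIV f x :> g"
  shows "((\<lambda>t. f (x + t *\<^sub>R d)) has_real_derivative (d \<bullet> g)) (at 0)"
proof -
  \<comment> \<open>The base point is written as the value of the line at \<open>0\<close>, the form
    that the chain rule expects.\<close>
  have "(f has_derivative (\<lambda>h. h \<bullet> g)) (at (x + 0 *\<^sub>R d))"
    using assms by (simp add: gderiv_def)
  moreover have "((\<lambda>t. x + t *\<^sub>R d) has_derivative (\<lambda>t. t *\<^sub>R d)) (at 0)"
    by (auto intro!: derivative_eq_intros)
  ultimately have "((\<lambda>t. f (x + t *\<^sub>R d)) has_derivative (\<lambda>t. (t *\<^sub>R d) \<bullet> g)) (at 0)"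
    using has_derivative_compose by fastforce
  then show ?thesis
    by (simp add: has_field_derivative_def mult.commute[of _ "d \<bullet> g"])
qed

text \<open>Along the line \<open>p\<close> through \<open>x\<close> and \<open>y\<close> this is
  the tangent inequality for a convex function of one variable, with the tangent at \<open>0\<close>
  and the comparison at \<open>1\<close>. The point \<open>y\<close> may lie on the boundary of
  \<open>S\<close>, so the domain is the whole preimage of \<open>S\<close>.\<close>

lemma convex_on_above_gradient:
  fixes f :: "'a::euclidean_space \<Rightarrow> real"
  assumes f: "convex_on S f" and x: "x \<in> interior S" and y: "y \<in> S" and g: "GDERIV f x :> g"
  shows "f y \<ge> f x + g \<bullet> (y - x)"
proof -
  define p where "p t = x + t *\<^sub>R (y - x)" for t :: real
  have p: "p ((1 - u) * s + u * t) = (1 - u) *\<^sub>R p s + u *\<^sub>R p t" for s t u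
    by (simp add: p_def algebra_simps)
  have cS: "convex S" using f by (rule convex_on_imp_convex)
  have con: "convex (p -` S)"
    unfolding convex_alt using cS by (auto simp: p convex_alt)
  have conv: "convex_on (p -` S) (\<lambda>t. f (p t))"
  proof (rule convex_onI[OF _ con])
    fix u s t :: real assume "0 < u" "u < 1" "s \<in> p -` S" "t \<in> p -` S"
    then show "f (p ((1 - u) *\<^sub>R s + u *\<^sub>R t)) \<le> (1 - u) * f (p s) + u * f (p t)"
      using convex_onD[OF f, of u "p s" "p t"] by (simp add: p)
  qed
  have "continuous_on UNIV p" unfolding p_def by (intro continuous_intros)
  then have "open (p -` interior S)" by (simp add: open_vimage)
  then have "p -` interior S \<subseteq> interior (p -` S)"
    using interior_subset by (intro interior_maximal) auto
  then have "0 \<in> interior (p -` S)" using x by (auto simp: p_def)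
  moreover have "((\<lambda>t. f (p t)) has_real_derivative ((y - x) \<bullet> g)) (at 0 within p -` S)"
    unfolding p_def by (rule has_field_derivative_at_within[OF gderiv_along_line[OF g]])
  ultimately have "f (p 1) - f (p 0) \<ge> ((y - x) \<bullet> g) * (1 - 0)"
    using y convex_connected[OF con]
    by (intro convex_on_imp_above_tangent[OF conv]) (auto simp: p_def)
  then show ?thesis by (simp add: p_def inner_commute)
qed

lemma legendre_function_gderiv:
  fixes f :: "'a::euclidean_space \<Rightarrow> ereal"
  assumes "legendre_function f" "x \<in> interior (effective_domain f)"
  shows "GDERIV (\<lambda>y. real_of_ereal (f y)) x :> ereal_gradient f x"
  unfolding ereal_gradient_def
  using assms by (intro differentiable_imp_gderiv_gradient)
    (auto simp: legendre_function_def essentially_smooth_def)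

section \<open>The Bregman distance\<close>

lemma bregman_eq_ereal:
  assumes "proper_function f" "x \<in> effective_domain f" "y \<in> effective_domain f"
  shows "bregman f y x =
    ereal (real_of_ereal (f y) - real_of_ereal (f x) - ereal_gradient f x \<bullet> (y - x))"
  using proper_function_eq_ereal[OF assms(1,2)] proper_function_eq_ereal[OF assms(1,3)]
  unfolding bregman_def by (metis ereal_minus(1))

text \<open>On the effective domain this is the gradient inequality; elsewhere \<open>f y\<close> is
  infinite while the subtracted terms are finite.\<close>

lemma bregman_nonneg:
  fixes f :: "'a::euclidean_space \<Rightarrow> ereal"
  assumes f: "legendre_function f" and x: "x \<in> interior (effective_domain f)"
  shows "bregman f y x \<ge> 0"
proof (cases "y \<in> effective_domain f")
  case True
  have "real_of_ereal (f y) \<ge> real_of_ereal (f x) + ereal_gradient f x \<bullet> (y - x)"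
    using convex_on_above_gradient[OF legendre_function_convex_on[OF f] x True
        legendre_function_gderiv[OF f x]] .
  then show ?thesis
    using f x True interior_subset by (subst bregman_eq_ereal) (auto simp: legendre_function_def)
next
  case False
  moreover have "f x = ereal (real_of_ereal (f x))"
    using f x interior_subset
    by (intro proper_function_eq_ereal) (auto simp: legendre_function_def)
  then have "bregman f y x = f y - ereal (real_of_ereal (f x)) - ereal (ereal_gradient f x \<bullet> (y - x))"
    unfolding bregman_def by metis
  ultimately show ?thesis by (simp add: effective_domain_def)
qed

text \<open>Subtracting the linearisation at \<open>x\<close> leaves a remainder of order
  \<open>o(t)\<close>, by the definition of the derivative along \<open>d\<close>.\<close>

lemma bregman_along_line_small:
  fixes f :: "'a::euclidean_space \<Rightarrow> ereal"
  assumes f: "legendre_function f" and x: "x \<in> interior (effective_domain f)" and "e > 0"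
  shows "\<forall>\<^sub>F t in at_right 0. bregman f (x + t *\<^sub>R d) x \<le> ereal (e * t)"
proof -
  let ?r = "\<lambda>y. real_of_ereal (f y)" and ?g = "ereal_gradient f x"
  have "((\<lambda>t. ?r (x + t *\<^sub>R d)) has_real_derivative (d \<bullet> ?g)) (at_right 0)"
    by (rule has_field_derivative_at_within[OF gderiv_along_line[OF legendre_function_gderiv[OF f x]]])
  then have "((\<lambda>t. (?r (x + t *\<^sub>R d) - ?r x) / t) \<longlongrightarrow> d \<bullet> ?g) (at_right 0)"
    by (simp add: has_field_derivative_iff)
  then have "\<forall>\<^sub>F t in at_right 0. (?r (x + t *\<^sub>R d) - ?r x) / t < d \<bullet> ?g + e"
    by (rule order_tendstoD) (use \<open>e > 0\<close> in auto)
  \<comment> \<open>Near \<open>x\<close> the line stays in the effective domain, where the distance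
    is given by real numbers.\<close>
  moreover have "\<forall>\<^sub>F t in at_right 0. x + t *\<^sub>R d \<in> interior (effective_domain f)"
  proof (rule topological_tendstoD)
    show "((\<lambda>t. x + t *\<^sub>R d) \<longlongrightarrow> x) (at_right 0)"
      by (auto intro!: tendsto_eq_intros)
  qed (use x in auto)
  ultimately show ?thesis
    using eventually_at_right_less[of 0]
  proof eventually_elim
    case (elim t)
    then have "?r (x + t *\<^sub>R d) - ?r x < (d \<bullet> ?g + e) * t" by (simp add: pos_divide_less_eq)
    then show ?case
      using elim(2) f x interior_subset
      by (subst bregman_eq_ereal)
        (auto simp: legendre_function_def inner_commute algebra_simps)
  qed
qed

section \<open>The two merit functions\<close>

text \<open>The term at \<open>x\<close> already keeps the supremum from being negative. In both
  merit functions \<open>x\<close> is the point of evaluation.\<close>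

lemma SUP_eq_0_iff:
  fixes f :: "'a \<Rightarrow> ereal"
  assumes "x \<in> A" "f x = 0"
  shows "(SUP y\<in>A. f y) = 0 \<longleftrightarrow> (\<forall>y\<in>A. f y \<le> 0)"
  using assms by (metis SUP_least SUP_upper antisym)

lemma merit_u_eq_0_iff:
  fixes C :: "'b::euclidean_space set"
  assumes C: "closed C" "convex C" "cone C" "pointed C" "interior C \<noteq> {}" and x: "x \<in> \<Omega>"
  shows "weakly_efficient C \<Omega> F x \<longleftrightarrow> merit_u C \<Omega> F x = 0"
proof -
  let ?m = "\<lambda>w. INF c\<in>dual_base C. ereal (c \<bullet> w)"
  have m: "?m w \<le> 0 \<longleftrightarrow> w \<notin> interior C" for w
  proof
    \<comment> \<open>Attainment matters here: positivity of every \<open>c \<bullet> w\<close>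
      alone would allow the infimum to be \<open>0\<close>.\<close>
    assume le: "?m w \<le> 0"
    obtain c where "c \<in> dual_base C" "?m w = ereal (c \<bullet> w)"
      using INF_dual_base_attained[OF C(1-4), of w 0] by auto
    with le show "w \<notin> interior C" using dual_base_inner_pos[of w C c] by auto
  next
    assume "w \<notin> interior C"
    then obtain c where "c \<in> dual_base C" "c \<bullet> w \<le> 0"
      using exists_dual_base_inner_nonpos[OF C(2,3,5)] by blast
    then show "?m w \<le> 0" by (intro INF_lower2[of c]) auto
  qed
  \<comment> \<open>Nonemptiness of the dual base is essential, as an infimum over the empty set
    would be \<open>\<infinity>\<close>.\<close>
  have "?m 0 = 0" using dual_base_nonempty[OF C(1-4)] by (simp flip: zero_ereal_def)
  then have "merit_u C \<Omega> F x = 0 \<longleftrightarrow> (\<forall>y\<in>\<Omega>. ?m (F x - F y) \<le> 0)"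
    unfolding merit_u_def using x by (intro SUP_eq_0_iff) auto
  then show ?thesis using x by (simp add: m weakly_efficient_def cone_less_def)
qed

lemma merit_v_eq_0_iff:
  fixes C :: "(real ^ 'm) set" and F :: "real ^ 'n \<Rightarrow> real ^ 'm"
  assumes C: "closed C" "convex C" "cone C" "pointed C" "interior C \<noteq> {}"
    and \<Omega>: "convex \<Omega>"
    and \<omega>: "legendre_function \<omega>" "closure (effective_domain \<omega>) = \<Omega>"
    and l: "l > 0" and x: "x \<in> interior \<Omega>"
  shows "C_stationary C \<Omega> F x \<longleftrightarrow> merit_v C \<Omega> F \<omega> l x = 0"
proof -
  let ?J = "jacobian F (at x)"
  let ?m = "\<lambda>y. INF c\<in>dual_base C. ereal (c \<bullet> (?J *v (x - y))) - ereal l * bregman \<omega> y x"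
  have x\<Omega>: "x \<in> \<Omega>" using x interior_subset by blast
  \<comment> \<open>A convex set and its closure have the same interior, so \<open>\<omega>\<close>
    is finite and differentiable at \<open>x\<close>.\<close>
  have xd: "x \<in> interior (effective_domain \<omega>)"
    using x convex_interior_closure convex_on_imp_convex[OF legendre_function_convex_on[OF \<omega>(1)]] \<omega>(2)
    by blast
  have "bregman \<omega> x x = 0"
    using xd \<omega>(1) interior_subset
    by (subst bregman_eq_ereal) (auto simp: legendre_function_def zero_ereal_def)
  then have "?m x = 0" using dual_base_nonempty[OF C(1-4)] by (simp flip: zero_ereal_def)
  then have v: "merit_v C \<Omega> F \<omega> l x = 0 \<longleftrightarrow> (\<forall>y\<in>\<Omega>. ?m y \<le> 0)"
    unfolding merit_v_def using x\<Omega> by (intro SUP_eq_0_iff) auto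
  have st: "C_stationary C \<Omega> F x \<longleftrightarrow> (\<forall>y\<in>\<Omega>. ?J *v (x - y) \<notin> interior C)"
  proof -
    have "?J *v (y - x) \<in> uminus ` interior C \<longleftrightarrow> ?J *v (x - y) \<in> interior C" for y
    proof -
      have "?J *v (y - x) = - (?J *v (x - y))"
        by (metis matrix_vector_mult_diff_distrib minus_diff_eq)
      then show ?thesis by (metis inj_image_mem_iff inj_uminus)
    qed
    then show ?thesis using x\<Omega> by (auto simp: C_stationary_def)
  qed
  show ?thesis
  proof
    assume stat: "C_stationary C \<Omega> F x"
    have "?m y \<le> 0" if y: "y \<in> \<Omega>" for y
    proof -
      \<comment> \<open>A single \<open>c\<close> with a nonpositive term bounds the infimum, and it
        may depend on \<open>y\<close>.\<close>
      obtain c where c: "c \<in> dual_base C" "c \<bullet> (?J *v (x - y)) \<le> 0"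
        using exists_dual_base_inner_nonpos[OF C(2,3,5)] stat y st by blast
      have "ereal l * bregman \<omega> y x \<ge> 0" using l bregman_nonneg[OF \<omega>(1) xd] by simp
      with c(2) have "ereal (c \<bullet> (?J *v (x - y))) - ereal l * bregman \<omega> y x \<le> 0 - 0"
        by (intro ereal_minus_mono) auto
      then show ?thesis using c(1) by (intro INF_lower2[of c]) auto
    qed
    then show "merit_v C \<Omega> F \<omega> l x = 0" using v by blast
  next
    assume "merit_v C \<Omega> F \<omega> l x = 0"
    then have le: "?m y \<le> 0" if "y \<in> \<Omega>" for y using v that by blast
    have "?J *v (x - y) \<notin> interior C" if y: "y \<in> \<Omega>" for y
    proof
      let ?w = "?J *v (x - y)"
      assume w: "?w \<in> interior C"
      obtain c0 where c0: "c0 \<in> dual_base C"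
          "(INF c\<in>dual_base C. ereal (c \<bullet> ?w)) = ereal (c0 \<bullet> ?w)"
        using INF_dual_base_attained[OF C(1-4), of ?w 0] by auto
      define m where "m = c0 \<bullet> ?w"
      have m: "m > 0" using dual_base_inner_pos[OF w c0(1)] by (simp add: m_def)
      have mle: "m \<le> c \<bullet> ?w" if "c \<in> dual_base C" for c
        using INF_lower[OF that, of "\<lambda>c. ereal (c \<bullet> ?w)"] c0(2) by (simp add: m_def)
      \<comment> \<open>The constant \<open>m / (2 * l)\<close> lets the penalty, after
        multiplication by \<open>l\<close>, use up at most half of the linear gain
        \<open>m * t\<close>.\<close>
      have "\<forall>\<^sub>F t in at_right 0. bregman \<omega> (x + t *\<^sub>R (y - x)) x \<le> ereal (m / (2 * l) * t)"
        using m l by (intro bregman_along_line_small \<omega>(1) xd) auto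
      moreover have "\<forall>\<^sub>F t in at_right 0. t < (1::real)"
        by (rule order_tendstoD[OF tendsto_ident_at]) auto
      ultimately have "\<forall>\<^sub>F t in at_right 0. 0 < t \<and> t < (1::real) \<and>
          bregman \<omega> (x + t *\<^sub>R (y - x)) x \<le> ereal (m / (2 * l) * t)"
        using eventually_at_right_less[of 0] by eventually_elim auto
      then obtain t where t: "0 < t" "t < (1::real)"
          "bregman \<omega> (x + t *\<^sub>R (y - x)) x \<le> ereal (m / (2 * l) * t)"
        using eventually_happens'[OF trivial_limit_at_right_real] by blast
      define z where "z = x + t *\<^sub>R (y - x)"
      have "z = (1 - t) *\<^sub>R x + t *\<^sub>R y" by (simp add: z_def algebra_simps)
      then have z: "z \<in> \<Omega>" using \<Omega> x\<Omega> y t by (simp add: convex_alt)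
      have xz: "x - z = t *\<^sub>R (x - y)" by (simp add: z_def algebra_simps)
      have "ereal l * bregman \<omega> z x \<le> ereal l * ereal (m / (2 * l) * t)"
        using t(3) l unfolding z_def by (intro ereal_mult_left_mono) auto
      then have B: "ereal l * bregman \<omega> z x \<le> ereal (m * t / 2)" using l by simp
      \<comment> \<open>The lower bound \<open>m\<close> holds for all \<open>c\<close> at once, so
        it survives the infimum; a gain of \<open>m * t / 2\<close> remains at \<open>z\<close>,
        against \<open>?m z \<le> 0\<close>.\<close>
      have "ereal (t * m) - ereal (m * t / 2) \<le> ?m z"
      proof (intro INF_greatest ereal_minus_mono B)
        fix c assume "c \<in> dual_base C"
        then show "ereal (t * m) \<le> ereal (c \<bullet> (?J *v (x - z)))"
          using mle t(1) by (simp add: xz matrix_vector_mult_scaleR)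
      qed
      also have "\<dots> \<le> 0" using le z by blast
      finally have "m * t \<le> 0" by simp
      with m t(1) show False by (simp add: mult_le_0_iff)
    qed
    then show "C_stationary C \<Omega> F x" using st by blast
  qed
qed

theorem theorem1:
  fixes C :: "(real ^ 'm) set"
    and \<Omega> :: "(real ^ 'n) set"
    and F :: "real ^ 'n \<Rightarrow> real ^ 'm"
    and \<omega> :: "real ^ 'n \<Rightarrow> ereal"
    and l :: real
  assumes "closed C" and "convex C" and "cone C" and "pointed C" and "interior C \<noteq> {}"
    and "closed \<Omega>" and "convex \<Omega>" and "interior \<Omega> \<noteq> {}"
    and "\<And>x. F differentiable (at x)"
    and "legendre_function \<omega>" and "closure (effective_domain \<omega>) = \<Omega>"
    and "l > 0"
  shows "(\<forall>x\<in>\<Omega>. weakly_efficient C \<Omega> F x \<longleftrightarrow> merit_u C \<Omega> F x = 0) \<and>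
         (\<forall>x\<in>interior \<Omega>. C_stationary C \<Omega> F x \<longleftrightarrow> merit_v C \<Omega> F \<omega> l x = 0)"
  by (intro conjI ballI merit_u_eq_0_iff[OF assms(1-5)] merit_v_eq_0_iff[OF assms(1-5,7,10-12)])

end
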